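(* Let $\mathscr{A}$ be a real Jordan algebra. There is a one-to-one correspondence between flat torsion-free connections $\nabla$ on $\mathscr{A}$ and LSSA-structures $\diamond$ on $\mathscr{A}$, given by $X\diamond Y=\nabla_XY$ for $X,Y\in\mathscr{A}$.
   Context: A (real) Jordan algebra is a real vector space $\mathscr{A}$ with a bilinear product satisfying $XY=YX$ and $X(X^2Y)=X^2(XY)$ for all $X,Y\in\mathscr{A}$. A connection on $\mathscr{A}$ is a bilinear map $\nabla:\mathscr{A}\times\mathscr{A}\to\mathscr{A}$, written $\nabla_XY:=\nabla(X,Y)$. It is torsion-free if $\nabla_XY+\nabla_YX=XY$ for all $X,Y$. Its curvature tensor is $R(X,Y)Z=-\nabla_X\nabla_YZ-\nabla_Y\nabla_XZ+\nabla_{XY}Z$, and $\nabla$ is flat if $R=0$. An LSSA-structure on $\mathscr{A}$ is a bilinear product $\diamond$ on the vector space $\mathscr{A}$ which is left skew-symmetric, i.e. $$(X\diamond Y)\diamond Z-X\diamond(Y\diamond Z)=-(Y\diamond X)\diamond Z+Y\diamond(X\diamond Z)\quad\text{for all }X,Y,Z\in\mathscr{A},$$ and which induces the given Jordan product, i.e. $X\diamond Y+Y\diamond X=XY$ for all $X,Y\in\mathscr{A}$. *)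

theory Defs
  imports "HOL-Analysis.Linear_Algebra"
begin

text \<open>A bilinear product on the real vector space \<open>'a\<close> (of any dimension) is a function
  \<open>'a \<Rightarrow> 'a \<Rightarrow> 'a\<close>. The Jordan product is not written \<open>*\<close>, since the ring classes require
  associativity.\<close>

definition real_jordan_algebra :: "('a::real_vector \<Rightarrow> 'a \<Rightarrow> 'a) \<Rightarrow> bool" where
  "real_jordan_algebra J \<longleftrightarrow>
     bilinear J \<and>
     (\<forall>X Y. J X Y = J Y X) \<and>
     (\<forall>X Y. J X (J (J X X) Y) = J (J X X) (J X Y))"

definition connection :: "('a::real_vector \<Rightarrow> 'a \<Rightarrow> 'a) \<Rightarrow> bool" where
  "connection nabla \<longleftrightarrow> bilinear nabla"

definition torsion_free ::
    "('a::real_vector \<Rightarrow> 'a \<Rightarrow> 'a) \<Rightarrow> ('a \<Rightarrow> 'a \<Rightarrow> 'a) \<Rightarrow> bool" where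
  "torsion_free J nabla \<longleftrightarrow> (\<forall>X Y. nabla X Y + nabla Y X = J X Y)"

definition curvature ::
    "('a::real_vector \<Rightarrow> 'a \<Rightarrow> 'a) \<Rightarrow> ('a \<Rightarrow> 'a \<Rightarrow> 'a) \<Rightarrow> 'a \<Rightarrow> 'a \<Rightarrow> 'a \<Rightarrow> 'a" where
  "curvature J nabla X Y Z =
     - nabla X (nabla Y Z) - nabla Y (nabla X Z) + nabla (J X Y) Z"

definition flat ::
    "('a::real_vector \<Rightarrow> 'a \<Rightarrow> 'a) \<Rightarrow> ('a \<Rightarrow> 'a \<Rightarrow> 'a) \<Rightarrow> bool" where
  "flat J nabla \<longleftrightarrow> (\<forall>X Y Z. curvature J nabla X Y Z = 0)"

definition left_skew_symmetric :: "('a::real_vector \<Rightarrow> 'a \<Rightarrow> 'a) \<Rightarrow> bool" where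
  "left_skew_symmetric D \<longleftrightarrow>
     (\<forall>X Y Z. D (D X Y) Z - D X (D Y Z) = - D (D Y X) Z + D Y (D X Z))"

definition LSSA_structure ::
    "('a::real_vector \<Rightarrow> 'a \<Rightarrow> 'a) \<Rightarrow> ('a \<Rightarrow> 'a \<Rightarrow> 'a) \<Rightarrow> bool" where
  "LSSA_structure J D \<longleftrightarrow>
     bilinear D \<and> left_skew_symmetric D \<and> (\<forall>X Y. D X Y + D Y X = J X Y)"

text \<open>Connections and products are both curried binary maps here, so this correspondence is
  the identity on the underlying functions.\<close>

definition product_of_connection ::
    "('a::real_vector \<Rightarrow> 'a \<Rightarrow> 'a) \<Rightarrow> 'a \<Rightarrow> 'a \<Rightarrow> 'a" where
  "product_of_connection nabla X Y = nabla X Y"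

end

theory Submission
  imports Defs
begin

text \<open>Torsion-freeness allows \<open>\<nabla>\<^bsub>XY\<^esub> Z\<close> to be replaced by \<open>(X \<diamond> Y) \<diamond> Z + (Y \<diamond> X) \<diamond> Z\<close> in the
  curvature. The curvature then becomes the associator \<open>(X \<diamond> Y) \<diamond> Z - X \<diamond> (Y \<diamond> Z)\<close> symmetrized in
  \<open>X\<close> and \<open>Y\<close>, and left skew-symmetry is exactly the vanishing of that symmetrization. Since
  being torsion-free is the same condition as inducing the given Jordan product, the two
  classes of bilinear maps coincide.\<close>

lemma curvature_eq_symmetrized_associator:
  assumes "bilinear nabla" and "torsion_free J nabla"
  shows "curvature J nabla X Y Z =
    (nabla (nabla X Y) Z - nabla X (nabla Y Z)) + (nabla (nabla Y X) Z - nabla Y (nabla X Z))"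
proof -
  have "nabla (J X Y) Z = nabla (nabla X Y + nabla Y X) Z"
    using assms(2) by (simp add: torsion_free_def)
  also have "\<dots> = nabla (nabla X Y) Z + nabla (nabla Y X) Z"
    using assms(1) by (rule bilinear_ladd)
  finally show ?thesis
    by (simp add: curvature_def)
qed

lemma flat_iff_left_skew_symmetric:
  assumes "bilinear nabla" and "torsion_free J nabla"
  shows "flat J nabla \<longleftrightarrow> left_skew_symmetric nabla"
proof -
  have "curvature J nabla X Y Z = 0 \<longleftrightarrow>
      nabla (nabla X Y) Z - nabla X (nabla Y Z) = - nabla (nabla Y X) Z + nabla Y (nabla X Z)"
    for X Y Z
    unfolding curvature_eq_symmetrized_associator[OF assms] by (simp add: add_eq_0_iff2)
  then show ?thesis
    by (simp add: flat_def left_skew_symmetric_def)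
qed

theorem corollary3p10:
  fixes J :: "'a::real_vector \<Rightarrow> 'a \<Rightarrow> 'a"
  assumes "real_jordan_algebra J"
  shows "bij_betw product_of_connection
           {nabla. connection nabla \<and> torsion_free J nabla \<and> flat J nabla}
           {D. LSSA_structure J D}"
proof -
  have "{nabla. connection nabla \<and> torsion_free J nabla \<and> flat J nabla} = {D. LSSA_structure J D}"
    using flat_iff_left_skew_symmetric[of _ J]
    by (auto simp: connection_def LSSA_structure_def torsion_free_def)
  moreover have "product_of_connection = (id :: ('a \<Rightarrow> 'a \<Rightarrow> 'a) \<Rightarrow> _)"
    by (simp add: fun_eq_iff product_of_connection_def)
  ultimately show ?thesis
    by simp
qed

end
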